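(* For every $n\ge 0$ let $G_n=G_n(x_{11},x_{12},x_2;y_{11},y_{12},y_2)$ be the polynomial defined in the context. Then, as formal power series in $q$, $$\sum_{n\geq 0}G_{n}(x_{11},x_{12},x_2;y_{11},y_{12},y_2)q^n=\frac{1+a_0q+a_1q^2-\sqrt{1+a_2q+a_3q^2+a_4q^3+a_5q^4}}{2q},$$ where $a_0=y_2-x_2$, $a_1=x_{12}y_{12}-x_{11}y_{11}$, $a_2=-2(x_2+y_2)$, $a_3=(x_2+y_2)^2-2(x_{11}y_{11}+x_{12}y_{12})$, $a_4=2(x_{11}y_{11}-x_{12}y_{12})(x_2-y_2)$, $a_5=(x_{11}y_{11}-x_{12}y_{12})^2$, and the square root is the formal power series with constant term $1$.
   Context: A plane tree is an unlabeled rooted tree in which the children of every vertex are linearly ordered from left to right; $\mathcal{P}_n$ denotes the set of plane trees with $n$ edges. A leaf is a vertex with no children; an interior vertex is a vertex with at least one child. A leaf without any siblings is a singleton leaf. A leaf with siblings is an elder leaf if it is the leftmost child of its parent, and a young leaf otherwise. An interior vertex is a young interior vertex if it is not the parent of a singleton leaf or of an elder leaf. For $T\in\mathcal P_n$ let $\mathrm{sleaf}(T),\mathrm{eleaf}(T),\mathrm{yleaf}(T)$ be the numbers of singleton, elder and young leaves, $\mathrm{sint}(T),\mathrm{eint}(T)$ the numbers of parents of singleton leaves and of parents of elder leaves, and $\mathrm{yint}(T)$ the number of young interior vertices. For $n\ge2$, $G_n(x_{11},x_{12},x_2;y_{11},y_{12},y_2)=\sum_{T\in\mathcal P_n}x_{11}^{\mathrm{sleaf}(T)}x_{12}^{\mathrm{eleaf}(T)}x_2^{\mathrm{yleaf}(T)}y_{11}^{\mathrm{sint}(T)}y_{12}^{\mathrm{eint}(T)}y_2^{\mathrm{yint}(T)}$,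 and by convention $G_0=y_2$ and $G_1=x_{12}y_{12}$. *)

theory Defs
  imports "HOL-Computational_Algebra.Formal_Power_Series"
begin

text \<open>
  A plane tree is given by the list of the subtrees at the children of its root, from left to
  right.  A vertex is its address: the root is \<open>[]\<close>, and \<open>u @ [i]\<close> is the child number \<open>i\<close>
  (counted from 0, from the left) of the vertex \<open>u\<close>.
\<close>

datatype plane_tree = Node "plane_tree list"

primrec vertices :: "plane_tree \<Rightarrow> nat list set" where
  "vertices (Node ts) = insert [] (\<Union>i<length ts. (#) i ` (map vertices ts ! i))"

definition edges :: "plane_tree \<Rightarrow> (nat list \<times> nat list) set" where
  "edges T = {(u, v). u \<in> vertices T \<and> v \<in> vertices T \<and> (\<exists>i. v = u @ [i])}"

definition plane_trees :: "nat \<Rightarrow> plane_tree set" where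
  "plane_trees n = {T. card (edges T) = n}"

definition children :: "plane_tree \<Rightarrow> nat list \<Rightarrow> nat list set" where
  "children T u = {v. (u, v) \<in> edges T}"

definition siblings :: "plane_tree \<Rightarrow> nat list \<Rightarrow> nat list set" where
  "siblings T v = {w. w \<noteq> v \<and> (\<exists>u. v \<in> children T u \<and> w \<in> children T u)}"

definition leftmost_child :: "plane_tree \<Rightarrow> nat list \<Rightarrow> bool" where
  "leftmost_child T v \<longleftrightarrow> (\<exists>u. v \<in> children T u \<and> v = u @ [0])"

definition leaves :: "plane_tree \<Rightarrow> nat list set" where
  "leaves T = {v \<in> vertices T. children T v = {}}"

definition interior_vertices :: "plane_tree \<Rightarrow> nat list set" where
  "interior_vertices T = {v \<in> vertices T. children T v \<noteq> {}}"

definition singleton_leaves :: "plane_tree \<Rightarrow> nat list set" where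
  "singleton_leaves T = {v \<in> leaves T. siblings T v = {}}"

definition elder_leaves :: "plane_tree \<Rightarrow> nat list set" where
  "elder_leaves T = {v \<in> leaves T. siblings T v \<noteq> {} \<and> leftmost_child T v}"

definition young_leaves :: "plane_tree \<Rightarrow> nat list set" where
  "young_leaves T = {v \<in> leaves T. siblings T v \<noteq> {} \<and> \<not> leftmost_child T v}"

definition singleton_parents :: "plane_tree \<Rightarrow> nat list set" where
  "singleton_parents T = {u \<in> vertices T. \<exists>v \<in> singleton_leaves T. v \<in> children T u}"

definition elder_parents :: "plane_tree \<Rightarrow> nat list set" where
  "elder_parents T = {u \<in> vertices T. \<exists>v \<in> elder_leaves T. v \<in> children T u}"

definition young_interior_vertices :: "plane_tree \<Rightarrow> nat list set" where
  "young_interior_vertices T =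
     {u \<in> interior_vertices T. u \<notin> singleton_parents T \<and> u \<notin> elder_parents T}"

definition sleaf :: "plane_tree \<Rightarrow> nat" where "sleaf T = card (singleton_leaves T)"
definition eleaf :: "plane_tree \<Rightarrow> nat" where "eleaf T = card (elder_leaves T)"
definition yleaf :: "plane_tree \<Rightarrow> nat" where "yleaf T = card (young_leaves T)"
definition sint :: "plane_tree \<Rightarrow> nat" where "sint T = card (singleton_parents T)"
definition eint :: "plane_tree \<Rightarrow> nat" where "eint T = card (elder_parents T)"
definition yint :: "plane_tree \<Rightarrow> nat" where "yint T = card (young_interior_vertices T)"

text \<open>The values at \<open>n = 0\<close> and \<open>n = 1\<close> are conventions and differ from the sum over trees.
  The six arguments are arbitrary ring elements; the polynomial itself is the value at
  indeterminates.\<close>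

definition G :: "nat \<Rightarrow> 'a \<Rightarrow> 'a \<Rightarrow> 'a \<Rightarrow> 'a \<Rightarrow> 'a \<Rightarrow> 'a \<Rightarrow> 'a::comm_semiring_1" where
  "G n x11 x12 x2 y11 y12 y2 =
     (if n = 0 then y2
      else if n = 1 then x12 * y12
      else \<Sum>T \<in> plane_trees n.
        x11 ^ sleaf T * x12 ^ eleaf T * x2 ^ yleaf T * y11 ^ sint T * y12 ^ eint T * y2 ^ yint T)"

text \<open>
  The square root with constant term 1 of a power series with constant term 1.  The first
  argument of \<^const>\<open>fps_radical\<close> selects the constant term of the root.
\<close>

definition fps_sqrt :: "'a::field_char_0 fps \<Rightarrow> 'a fps" where
  "fps_sqrt A = fps_radical (\<lambda>_ _. 1) 2 A"

lemma fps_sqrt_iff: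
  fixes A S :: "'a::field_char_0 fps"
  assumes "fps_nth A 0 = 1"
  shows "S = fps_sqrt A \<longleftrightarrow> S ^ 2 = A \<and> fps_nth S 0 = 1"
  using radical_unique[of "\<lambda>_ _. 1" 1 A S] power_radical[of A "\<lambda>_ _. 1" 1] assms
  by (auto simp: fps_sqrt_def numeral_2_eq_2)

end

theory Submission
  imports Defs
begin

text \<open>
  Singleton and elder leaves correspond bijectively to their parents, so \<open>G n\<close> depends only on
  \<open>a = x11 * y11\<close>, \<open>b = x12 * y12\<close>, \<open>x = x2\<close> and \<open>y = y2\<close>.  Give the one-vertex tree the weight
  \<open>x\<close>, and let \<open>C\<close> and \<open>R = 1 / (1 - q C)\<close> be the generating functions of trees and of sequences
  of planted trees.  Splitting off the first subtree of the root, which contributes \<open>b\<close> if it is a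
  leaf and \<open>y\<close> times its weight otherwise, gives \<open>C = x + q (b + y (C - x)) R + (a - b) q\<close>, where
  the last term corrects the tree with a single edge.  The conventions for \<open>G 0\<close> and \<open>G 1\<close> are such
  that the generating function of \<open>G\<close> is \<open>F = C - x + y + (b - a) q\<close>; eliminating \<open>R\<close> yields a
  quadratic equation for \<open>F\<close>.
\<close>

section \<open>Addresses, subtrees and counting vertices recursively\<close>

primrec subtrees :: "plane_tree \<Rightarrow> plane_tree list" where
  "subtrees (Node ts) = ts"

fun subtree_at :: "plane_tree \<Rightarrow> nat list \<Rightarrow> plane_tree" where
  "subtree_at T [] = T"
| "subtree_at T (i # u) = subtree_at (subtrees T ! i) u"

lemma subtrees_eq_iff: "subtrees T = ts \<longleftrightarrow> T = Node ts"
  by (cases T) simp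

lemma subtree_at_append: "subtree_at T (u @ v) = subtree_at (subtree_at T u) v"
  by (induction u arbitrary: T) auto

lemma Nil_in_vertices [simp]: "[] \<in> vertices T"
  by (cases T) simp

lemma Cons_in_vertices_iff [simp]:
  "i # u \<in> vertices T \<longleftrightarrow> i < length (subtrees T) \<and> u \<in> vertices (subtrees T ! i)"
  by (cases T) auto

lemma snoc_in_vertices_iff [simp]:
  "u @ [i] \<in> vertices T \<longleftrightarrow> u \<in> vertices T \<and> i < length (subtrees (subtree_at T u))"
  by (induction u arbitrary: T) auto

lemma finite_vertices [simp]: "finite (vertices T)"
  by (induction T) (auto simp: set_conv_nth)

declare vertices.simps [simp del]

text \<open>Nonempty addresses are split by their first entry. Every vertex statistic below gets its
  recursion over the root's subtrees from this.\<close>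

lemma card_vertices_filter_Node:
  "card {u \<in> vertices (Node ts). Q u} =
     of_bool (Q []) + (\<Sum>i<length ts. card {u \<in> vertices (ts ! i). Q (i # u)})"
proof -
  let ?A = "\<lambda>i. (#) i ` {u \<in> vertices (ts ! i). Q (i # u)}"
  have eq: "{u \<in> vertices (Node ts). Q u} =
      (if Q [] then {[]} else {}) \<union> (\<Union>i<length ts. ?A i)"
    by (auto simp: vertices.simps)
  have "card (\<Union>i<length ts. ?A i) = (\<Sum>i<length ts. card (?A i))"
    by (rule card_UN_disjoint) auto
  also have "\<dots> = (\<Sum>i<length ts. card {u \<in> vertices (ts ! i). Q (i # u)})"
    by (intro sum.cong refl card_image) auto
  finally have card_UN: "card (\<Union>i<length ts. ?A i) = \<dots>" .
  show ?thesis
    unfolding eq by (subst card_Un_disjoint) (auto simp: card_UN)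
qed

lemma card_vertices_filter_Node_Cons:
  "card {u \<in> vertices (Node (t # ts)). Q u} =
     of_bool (Q []) + card {u \<in> vertices t. Q (0 # u)} +
     (\<Sum>i<length ts. card {u \<in> vertices (ts ! i). Q (Suc i # u)})"
  unfolding card_vertices_filter_Node by (simp add: sum.lessThan_Suc_shift del: sum.lessThan_Suc)

definition subtree_count :: "(plane_tree \<Rightarrow> bool) \<Rightarrow> plane_tree \<Rightarrow> nat" where
  "subtree_count P T = card {u \<in> vertices T. P (subtree_at T u)}"

lemma subtree_count_Node:
  "subtree_count P (Node ts) = of_bool (P (Node ts)) + sum_list (map (subtree_count P) ts)"
  unfolding subtree_count_def
  by (simp add: card_vertices_filter_Node sum_list_sum_nth atLeast0LessThan)

text \<open>The root counts as young when it is a leaf: this is the weight a leaf carries as a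
  non-first child.\<close>

definition young_count :: "plane_tree \<Rightarrow> nat" where
  "young_count T =
     card {u \<in> vertices T. subtree_at T u = Node [] \<and> (u = [] \<or> last u \<noteq> 0)}"

lemma young_count_Nil [simp]: "young_count (Node []) = 1"
  unfolding young_count_def by (simp add: card_vertices_filter_Node)

text \<open>Prepending an index changes the last entry of an address only if that address is
  \<open>[]\<close>. So only the root of a subtree can change status, and it does so exactly when it
  is a leaf placed as first child.\<close>

lemma young_count_Node_Cons:
  "young_count (Node (t # ts)) =
     (if t = Node [] then 0 else young_count t) + sum_list (map young_count ts)"
proof -
  have "card {u \<in> vertices t. subtree_at t u = Node [] \<and> last (0 # u) \<noteq> 0} =
      (if t = Node [] then 0 else young_count t)"
  proof (cases "t = Node []")
    case True
    have "{u \<in> vertices t. subtree_at t u = Node [] \<and> last (0 # u) \<noteq> 0} = {}"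
      using True by (auto simp: vertices.simps)
    then show ?thesis
      using True by simp
  next
    case False
    then have "{u \<in> vertices t. subtree_at t u = Node [] \<and> last (0 # u) \<noteq> 0} =
        {u \<in> vertices t. subtree_at t u = Node [] \<and> (u = [] \<or> last u \<noteq> 0)}"
      by auto
    with False show ?thesis
      by (simp add: young_count_def)
  qed
  moreover have "card {u \<in> vertices s. subtree_at s u = Node [] \<and> last (Suc i # u) \<noteq> 0} =
      young_count s" for s i
    unfolding young_count_def by (rule arg_cong[where f = card]) auto
  ultimately show ?thesis
    unfolding young_count_def[of "Node (t # ts)"]
    by (simp add: card_vertices_filter_Node_Cons sum_list_sum_nth atLeast0LessThan)
qed

section \<open>Edges, and leaves and interior vertices described by local subtrees\<close>

lemma edges_eq: "edges T = (\<lambda>v. (butlast v, v)) ` (vertices T - {[]})"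
proof -
  have "v \<in> vertices T - {[]} \<Longrightarrow> (butlast v, v) \<in> edges T" for v
    by (cases v rule: rev_cases) (auto simp: edges_def)
  then show ?thesis
    by (force simp: edges_def)
qed

lemma card_edges: "card (edges T) = card (vertices T) - 1"
  unfolding edges_eq by (subst card_image) (auto simp: inj_on_def)

lemma card_vertices_eq: "card (vertices T) = Suc (card (edges T))"
proof -
  have "card (vertices T) > 0"
    by (simp add: card_gt_0_iff) (metis Nil_in_vertices empty_iff)
  then show ?thesis
    by (simp add: card_edges)
qed

lemma card_edges_Node:
  "card (edges (Node ts)) = sum_list (map (\<lambda>t. Suc (card (edges t))) ts)"
proof -
  have "card (vertices (Node ts)) = Suc (sum_list (map (\<lambda>t. card (vertices t)) ts))"
    using subtree_count_Node[of "\<lambda>_. True" ts] by (simp add: subtree_count_def[abs_def])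
  then show ?thesis
    by (simp add: card_vertices_eq)
qed

lemma children_eq:
  "children T u =
     (if u \<in> vertices T then (\<lambda>i. u @ [i]) ` {..<length (subtrees (subtree_at T u))} else {})"
  by (auto simp: children_def edges_def)

lemma snoc_in_children_iff [simp]:
  "u @ [i] \<in> children T w \<longleftrightarrow> u = w \<and> u @ [i] \<in> vertices T"
  by (auto simp: children_eq)

lemma children_empty_iff:
  "u \<in> vertices T \<Longrightarrow> children T u = {} \<longleftrightarrow> subtree_at T u = Node []"
  by (simp add: children_eq subtrees_eq_iff lessThan_empty_iff)

lemma leaves_eq: "leaves T = {u \<in> vertices T. subtree_at T u = Node []}"
  by (simp add: leaves_def children_empty_iff cong: conj_cong)

lemma interior_vertices_eq: "interior_vertices T = {u \<in> vertices T. subtree_at T u \<noteq> Node []}"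
  by (simp add: interior_vertices_def children_empty_iff cong: conj_cong)

lemma siblings_snoc:
  "u @ [i] \<in> vertices T \<Longrightarrow>
     siblings T (u @ [i]) = (\<lambda>j. u @ [j]) ` ({..<length (subtrees (subtree_at T u))} - {i})"
  by (auto simp: siblings_def children_eq)

lemma siblings_snoc_empty_iff:
  assumes "u @ [i] \<in> vertices T"
  shows "siblings T (u @ [i]) = {} \<longleftrightarrow> length (subtrees (subtree_at T u)) = 1"
proof -
  let ?n = "length (subtrees (subtree_at T u))"
  have "i < ?n"
    using assms by simp
  have "{..<?n} - {i} = {} \<longleftrightarrow> card ({..<?n} - {i}) = 0"
    by (rule card_0_eq[symmetric]) simp
  also have "\<dots> \<longleftrightarrow> ?n = 1"
    using \<open>i < ?n\<close> by (simp add: card_Diff_singleton) linarith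
  finally have "{..<?n} - {i} = {} \<longleftrightarrow> ?n = 1" .
  then show ?thesis
    using siblings_snoc[OF assms] by simp
qed

lemma leftmost_child_snoc [simp]:
  "leftmost_child T (u @ [i]) \<longleftrightarrow> u @ [i] \<in> vertices T \<and> i = 0"
  by (auto simp: leftmost_child_def)

lemma snoc_in_leaves_iff:
  "u @ [i] \<in> leaves T \<longleftrightarrow>
     u \<in> vertices T \<and> i < length (subtrees (subtree_at T u)) \<and>
     subtrees (subtree_at T u) ! i = Node []"
  by (simp add: leaves_eq subtree_at_append)

lemma snoc_in_singleton_leaves_iff:
  "u @ [i] \<in> singleton_leaves T \<longleftrightarrow>
     u @ [i] \<in> leaves T \<and> length (subtrees (subtree_at T u)) = 1"
  by (simp add: singleton_leaves_def snoc_in_leaves_iff siblings_snoc_empty_iff cong: conj_cong)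

lemma snoc_in_elder_leaves_iff:
  "u @ [i] \<in> elder_leaves T \<longleftrightarrow>
     u @ [i] \<in> leaves T \<and> length (subtrees (subtree_at T u)) \<noteq> 1 \<and> i = 0"
  by (simp add: elder_leaves_def snoc_in_leaves_iff siblings_snoc_empty_iff cong: conj_cong)

text \<open>A nonzero index already forces a sibling to the left.\<close>

lemma snoc_in_young_leaves_iff:
  "u @ [i] \<in> young_leaves T \<longleftrightarrow> u @ [i] \<in> leaves T \<and> i \<noteq> 0"
  by (auto simp: young_leaves_def snoc_in_leaves_iff siblings_snoc_empty_iff cong: conj_cong)

context
  fixes T :: plane_tree
  assumes T: "T \<noteq> Node []"
begin

text \<open>A singleton leaf is sent to its parent, whose subtree is a single edge. The one-vertex
  tree is excluded because its root is a leaf without siblings, hence a singleton leaf, but has no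
  parent.\<close>

lemma singleton_leaves_eq:
  "singleton_leaves T = (\<lambda>u. u @ [0]) ` {u \<in> vertices T. subtree_at T u = Node [Node []]}"
  (is "_ = ?g ` ?A")
proof (rule set_eqI)
  fix v
  show "v \<in> singleton_leaves T \<longleftrightarrow> v \<in> ?g ` ?A"
  proof (cases v rule: rev_cases)
    case Nil
    then show ?thesis
      using T by (auto simp: singleton_leaves_def leaves_eq)
  next
    case (snoc u i)
    show ?thesis
      unfolding snoc
      by (cases "subtree_at T u")
        (auto simp: snoc_in_singleton_leaves_iff snoc_in_leaves_iff length_Suc_conv)
  qed
qed

lemma singleton_parents_eq:
  "singleton_parents T = {u \<in> vertices T. subtree_at T u = Node [Node []]}"
  by (auto simp: singleton_parents_def singleton_leaves_eq)

lemma elder_leaves_eq: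
  "elder_leaves T =
     (\<lambda>u. u @ [0]) ` {u \<in> vertices T. \<exists>t ts. subtree_at T u = Node (Node [] # t # ts)}"
  (is "_ = ?g ` ?A")
proof (rule set_eqI)
  fix v
  show "v \<in> elder_leaves T \<longleftrightarrow> v \<in> ?g ` ?A"
  proof (cases v rule: rev_cases)
    case Nil
    then show ?thesis
      using T by (auto simp: elder_leaves_def leaves_eq)
  next
    case (snoc u i)
    show ?thesis
      unfolding snoc
    proof (cases "subtree_at T u")
      case (Node ts)
      then show "u @ [i] \<in> elder_leaves T \<longleftrightarrow> u @ [i] \<in> ?g ` ?A"
        by (cases ts; cases "tl ts") (auto simp: snoc_in_elder_leaves_iff snoc_in_leaves_iff)
    qed
  qed
qed

lemma elder_parents_eq:
  "elder_parents T = {u \<in> vertices T. \<exists>t ts. subtree_at T u = Node (Node [] # t # ts)}"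
  by (auto simp: elder_parents_def elder_leaves_eq)

text \<open>The right-hand side is the set counted by \<open>young_count\<close>. Its disjunct
  \<open>u = []\<close> adds nothing to the young leaves here, since the root of \<open>T\<close> is
  not a leaf.\<close>

lemma young_leaves_eq:
  "young_leaves T = {u \<in> vertices T. subtree_at T u = Node [] \<and> (u = [] \<or> last u \<noteq> 0)}"
  (is "_ = ?A")
proof (rule set_eqI)
  fix v
  show "v \<in> young_leaves T \<longleftrightarrow> v \<in> ?A"
  proof (cases v rule: rev_cases)
    case Nil
    then show ?thesis
      using T by (auto simp: young_leaves_def leaves_eq)
  next
    case (snoc u i)
    show ?thesis
      unfolding snoc
      by (auto simp: snoc_in_young_leaves_iff leaves_eq)
  qed
qed

lemma young_interior_vertices_eq:
  "young_interior_vertices T =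
     {u \<in> vertices T. \<exists>t ts. subtree_at T u = Node (t # ts) \<and> t \<noteq> Node []}"
proof -
  \<comment> \<open>A nonempty list of subtrees is a lone leaf, a leaf followed by something, or
    starts with a non-leaf; the last case is the young one.\<close>
  have key: "t \<noteq> Node [] \<and> t \<noteq> Node [Node []] \<and> (\<nexists>s ts. t = Node (Node [] # s # ts)) \<longleftrightarrow>
      (\<exists>s ts. t = Node (s # ts) \<and> s \<noteq> Node [])" for t
  proof (cases t)
    case (Node ts)
    then show ?thesis
      by (cases ts; cases "tl ts") auto
  qed
  show ?thesis
    unfolding young_interior_vertices_def interior_vertices_eq singleton_parents_eq
      elder_parents_eq key[symmetric] by auto
qed

end

section \<open>The weight of a tree and its factorization\<close>

definition tree_weight :: "'a \<Rightarrow> 'a \<Rightarrow> 'a \<Rightarrow> 'a \<Rightarrow> plane_tree \<Rightarrow> 'a::comm_semiring_1" where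
  "tree_weight a b x y T =
     a ^ subtree_count (\<lambda>t. t = Node [Node []]) T *
     b ^ subtree_count (\<lambda>t. \<exists>s ts. t = Node (Node [] # s # ts)) T *
     x ^ young_count T *
     y ^ subtree_count (\<lambda>t. \<exists>s ts. t = Node (s # ts) \<and> s \<noteq> Node []) T"

text \<open>The map \<open>u\<close> to \<open>u @ [0]\<close> is injective, so
  \<open>sleaf T = sint T\<close> and \<open>eleaf T = eint T\<close>; the corresponding variables
  occur only as products.\<close>

lemma tree_weight_eq:
  assumes "T \<noteq> Node []"
  shows "tree_weight (x11 * y11) (x12 * y12) x2 y2 T =
    x11 ^ sleaf T * x12 ^ eleaf T * x2 ^ yleaf T * y11 ^ sint T * y12 ^ eint T * y2 ^ yint T"
  by (simp add: tree_weight_def sleaf_def eleaf_def yleaf_def sint_def eint_def yint_def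
      singleton_leaves_eq[OF assms] singleton_parents_eq[OF assms] elder_leaves_eq[OF assms]
      elder_parents_eq[OF assms] young_leaves_eq[OF assms] young_interior_vertices_eq[OF assms]
      subtree_count_def young_count_def card_image inj_on_def power_mult_distrib mult_ac)

lemma tree_weight_Nil [simp]: "tree_weight a b x y (Node []) = x"
  by (simp add: tree_weight_def subtree_count_Node)

lemma power_sum_list: "(z::'a::comm_monoid_mult) ^ sum_list (map f ts) = (\<Prod>t\<leftarrow>ts. z ^ f t)"
  by (induction ts) (auto simp: power_add)

lemma prod_list_map_mult:
  "(\<Prod>t\<leftarrow>ts. f t * g t) = (\<Prod>t\<leftarrow>ts. f t) * (\<Prod>t\<leftarrow>ts. (g t :: 'a::comm_monoid_mult))"
  by (induction ts) (auto simp: mult_ac)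

text \<open>A leaf as first child gives no factor \<open>x\<close>; it makes the root contribute
  \<open>a\<close> or \<open>b\<close>. Otherwise the root is a young interior vertex and
  contributes \<open>y\<close>.\<close>

lemma tree_weight_Node_Cons:
  "tree_weight a b x y (Node (t # ts)) =
     (if t = Node [] then (if ts = [] then a else b) else y * tree_weight a b x y t) *
     (\<Prod>s\<leftarrow>ts. tree_weight a b x y s)"
  by (cases ts)
    (auto simp: tree_weight_def subtree_count_Node young_count_Node_Cons
      power_add power_sum_list prod_list_map_mult mult_ac)

section \<open>Forests of planted trees and their generating functions\<close>

definition forests :: "nat \<Rightarrow> plane_tree list set" where
  "forests n = {ts. sum_list (map (\<lambda>t. Suc (card (edges t))) ts) = n}"

lemma plane_trees_eq: "plane_trees n = Node ` forests n"
proof -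
  have "T \<in> plane_trees n \<longleftrightarrow> T \<in> Node ` forests n" for T
    by (cases T) (auto simp: plane_trees_def forests_def card_edges_Node)
  then show ?thesis
    by blast
qed

lemma forests_0 [simp]: "forests 0 = {[]}"
  by (auto simp: forests_def)

lemma forests_Suc:
  "forests (Suc n) =
     (\<Union>k\<le>n. (\<lambda>(t, ts). t # ts) ` (plane_trees k \<times> forests (n - k)))"
proof (rule set_eqI)
  fix us
  show "us \<in> forests (Suc n) \<longleftrightarrow>
      us \<in> (\<Union>k\<le>n. (\<lambda>(t, ts). t # ts) ` (plane_trees k \<times> forests (n - k)))"
    by (cases us) (auto simp: forests_def plane_trees_def image_iff)
qed

lemma finite_forests [simp]: "finite (forests n)"
proof (induction n rule: less_induct)
  case (less n)
  then show ?case
    by (cases n) (auto simp: forests_Suc plane_trees_eq)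
qed

lemma finite_plane_trees [simp]: "finite (plane_trees n)"
  by (simp add: plane_trees_eq)

lemma sum_forests_Suc:
  "(\<Sum>us\<in>forests (Suc n). h us) =
     (\<Sum>k\<le>n. \<Sum>t\<in>plane_trees k. \<Sum>ts\<in>forests (n - k). h (t # ts))"
proof -
  have "(\<Sum>us\<in>forests (Suc n). h us) =
      (\<Sum>k\<le>n. \<Sum>us\<in>(\<lambda>(t, ts). t # ts) ` (plane_trees k \<times> forests (n - k)). h us)"
    \<comment> \<open>The pieces are disjoint because \<open>k\<close> is the number of edges of the
      first tree.\<close>
    unfolding forests_Suc by (rule sum.UNION_disjoint) (auto, auto simp: plane_trees_def)
  also have "\<dots> = (\<Sum>k\<le>n. \<Sum>(t, ts)\<in>plane_trees k \<times> forests (n - k). h (t # ts))"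
    by (intro sum.cong refl, subst sum.reindex) (auto simp: inj_on_def split_def)
  also have "\<dots> = (\<Sum>k\<le>n. \<Sum>t\<in>plane_trees k. \<Sum>ts\<in>forests (n - k). h (t # ts))"
    by (simp add: sum.cartesian_product)
  finally show ?thesis .
qed

definition tree_gf :: "(plane_tree \<Rightarrow> 'a) \<Rightarrow> 'a::comm_semiring_1 fps" where
  "tree_gf f = Abs_fps (\<lambda>n. \<Sum>T\<in>plane_trees n. f T)"

definition forest_gf :: "(plane_tree list \<Rightarrow> 'a) \<Rightarrow> 'a::comm_semiring_1 fps" where
  "forest_gf h = Abs_fps (\<lambda>n. \<Sum>ts\<in>forests n. h ts)"

lemma tree_gf_eq_forest_gf: "tree_gf f = forest_gf (\<lambda>ts. f (Node ts))"
  unfolding tree_gf_def forest_gf_def plane_trees_eq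
  by (subst sum.reindex) (auto simp: inj_on_def)

text \<open>A nonempty forest is a first tree and a remaining forest; the factor
  \<open>fps_X\<close> marks the edge joining the first tree to the root. Separate \<open>f\<close>
  and \<open>g\<close> allow the first tree a weight of its own.\<close>

lemma forest_gf_Cons:
  assumes "\<And>t ts. h (t # ts) = f t * g ts"
  shows "forest_gf h = fps_const (h []) + fps_X * tree_gf f * forest_gf g"
proof (rule fps_ext)
  fix n
  show "fps_nth (forest_gf h) n =
      fps_nth (fps_const (h []) + fps_X * tree_gf f * forest_gf g) n"
  proof (cases n)
    case 0
    then show ?thesis
      by (simp add: forest_gf_def mult.assoc)
  next
    case (Suc m)
    have "fps_nth (forest_gf h) n = fps_nth (tree_gf f * forest_gf g) m"
      by (simp add: Suc forest_gf_def tree_gf_def fps_mult_nth sum_forests_Suc assms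
          sum_product atLeast0AtMost)
    then show ?thesis
      by (simp add: Suc mult.assoc)
  qed
qed

lemma plane_trees_0 [simp]: "plane_trees 0 = {Node []}"
  by (simp add: plane_trees_eq)

lemma Nil_in_plane_trees_iff: "Node [] \<in> plane_trees n \<longleftrightarrow> n = 0"
  by (auto simp: plane_trees_def card_edges_Node)

lemma Node_Nil_in_plane_trees_iff: "Node [Node []] \<in> plane_trees n \<longleftrightarrow> n = 1"
  by (auto simp: plane_trees_def card_edges_Node)

lemma tree_gf_indicator:
  "tree_gf (\<lambda>T. if T = Node [] then c else 0) = fps_const c"
  "tree_gf (\<lambda>T. if T = Node [Node []] then c else 0) = fps_const c * fps_X"
  by (rule fps_ext, auto simp: tree_gf_def sum.delta Nil_in_plane_trees_iff
      Node_Nil_in_plane_trees_iff)+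

lemma tree_gf_add: "tree_gf (\<lambda>T. f T + g T) = tree_gf f + tree_gf g"
  by (rule fps_ext) (simp add: tree_gf_def sum.distrib)

lemma tree_gf_cmult: "tree_gf (\<lambda>T. c * f T) = fps_const c * tree_gf f"
  by (rule fps_ext) (simp add: tree_gf_def sum_distrib_left)

section \<open>The quadratic equation and its solution\<close>

lemma tree_weight_gf_quadratic:
  fixes a b x y :: "'a::comm_ring_1"
  defines "F \<equiv> tree_gf (tree_weight a b x y) - fps_const x + fps_const y + fps_const (b - a) * fps_X"
  shows "fps_X * F\<^sup>2 + fps_const y + fps_const (b - x * y) * fps_X =
    F * (1 + fps_const (y - x) * fps_X + fps_const (b - a) * fps_X\<^sup>2)"
proof -
  let ?w = "tree_weight a b x y"
  let ?v = "\<lambda>ts. \<Prod>t\<leftarrow>ts. ?w t"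
  let ?d = "\<lambda>t. if t = Node [] then b else y * ?w t"
  define C where "C = tree_gf ?w"
  define R where "R = forest_gf ?v"
  define D where "D = tree_gf ?d"
  have R: "R = 1 + fps_X * C * R"
    unfolding R_def C_def by (subst forest_gf_Cons[where f = ?w and g = ?v]) auto
  have D: "D = fps_const y * C + fps_const (b - y * x)"
  proof -
    \<comment> \<open>At the one-vertex tree \<open>?w\<close> is \<open>x\<close>, so
      \<open>y * ?w\<close> must be corrected from \<open>y * x\<close> to \<open>b\<close>.\<close>
    have "?d = (\<lambda>t. y * ?w t + (if t = Node [] then b - y * x else 0))"
      by (auto simp: fun_eq_iff)
    then have "D = tree_gf (\<lambda>t. y * ?w t + (if t = Node [] then b - y * x else 0))"
      unfolding D_def by simp
    then show ?thesis
      unfolding tree_gf_add tree_gf_cmult tree_gf_indicator C_def .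
  qed
  have C: "C = fps_const x + fps_X * D * R + fps_const (a - b) * fps_X"
  proof -
    define h where "h = (\<lambda>ts. case ts of [] \<Rightarrow> x | t # ts \<Rightarrow> ?d t * ?v ts)"
    \<comment> \<open>\<open>h\<close> gives every leaf in first position the factor
      \<open>b\<close>; only for the single edge should it be \<open>a\<close>.\<close>
    have "?w T = h (subtrees T) + (if T = Node [Node []] then a - b else 0)" for T
    proof (cases T)
      case (Node ts)
      then show ?thesis
        by (cases ts) (auto simp: h_def tree_weight_Node_Cons)
    qed
    then have "C = tree_gf (\<lambda>T. h (subtrees T) + (if T = Node [Node []] then a - b else 0))"
      unfolding C_def by presburger
    also have "\<dots> = forest_gf h + fps_const (a - b) * fps_X"
      by (simp only: tree_gf_add tree_gf_indicator tree_gf_eq_forest_gf[of "\<lambda>T. h (subtrees T)"]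
          subtrees.simps)
    also have "forest_gf h = fps_const x + fps_X * D * R"
      unfolding D_def R_def by (subst forest_gf_Cons[where f = ?d and g = ?v]) (auto simp: h_def)
    finally show ?thesis .
  qed
  have F: "F = C - fps_const x + fps_const y + fps_const (b - a) * fps_X"
    by (simp add: F_def C_def)
  have "F - fps_const y = fps_X * D * R"
    unfolding F by (subst C) (simp flip: fps_const_sub add: algebra_simps)
  \<comment> \<open>Since \<open>1 - fps_X * C\<close> is inverse to \<open>R\<close>, multiplying
    by it eliminates \<open>R\<close> without any division.\<close>
  then have "(F - fps_const y) * (1 - fps_X * C) = fps_X * D * (R - fps_X * C * R)"
    by (simp add: algebra_simps)
  also have "R - fps_X * C * R = 1"
    using R by (simp add: algebra_simps)
  finally have "(F - fps_const y) * (1 - fps_X * C) = fps_X * D"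
    by simp
  moreover have "C = F + fps_const x - fps_const y - fps_const (b - a) * fps_X"
    by (simp add: F)
  ultimately show ?thesis
    unfolding D
    by (simp flip: fps_const_sub fps_const_mult fps_const_neg add: algebra_simps power2_eq_square)
qed

text \<open>The conventions replace the constant term \<open>x2\<close> by \<open>y2\<close>, and
  the weight \<open>x11 * y11\<close> of the single edge by \<open>x12 * y12\<close>; from degree 2
  on the coefficients agree.\<close>

lemma G_gf:
  fixes x11 x12 x2 y11 y12 y2 :: "'a::comm_ring_1"
  shows "Abs_fps (\<lambda>n. G n x11 x12 x2 y11 y12 y2) =
    tree_gf (tree_weight (x11 * y11) (x12 * y12) x2 y2) - fps_const x2 + fps_const y2
      + fps_const (x12 * y12 - x11 * y11) * fps_X"
    (is "_ = ?F")
proof (rule fps_ext)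
  fix n
  consider "n = (0::nat)" | "n = 1" | "n \<ge> 2" by linarith
  then show "fps_nth (Abs_fps (\<lambda>n. G n x11 x12 x2 y11 y12 y2)) n = fps_nth ?F n"
  proof cases
    case 1
    then show ?thesis
      by (simp add: G_def tree_gf_def)
  next
    case 2
    have "plane_trees 1 = {Node [Node []]}"
      using forests_Suc[of 0] by (simp add: plane_trees_eq)
    with 2 show ?thesis
      by (simp add: G_def tree_gf_def tree_weight_Node_Cons)
  next
    case 3
    then have "T \<noteq> Node []" if "T \<in> plane_trees n" for T
      using that Nil_in_plane_trees_iff[of n] by auto
    then have "G n x11 x12 x2 y11 y12 y2 =
        (\<Sum>T\<in>plane_trees n. tree_weight (x11 * y11) (x12 * y12) x2 y2 T)"
      using 3 by (simp add: G_def tree_weight_eq cong: sum.cong)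
    then show ?thesis
      using 3 by (simp add: tree_gf_def)
  qed
qed

theorem theorem1p8:
  fixes x11 x12 x2 y11 y12 y2 a0 a1 a2 a3 a4 a5 :: "'a::field_char_0"
  assumes "a0 = y2 - x2"
    and "a1 = x12 * y12 - x11 * y11"
    and "a2 = - 2 * (x2 + y2)"
    and "a3 = (x2 + y2)^2 - 2 * (x11 * y11 + x12 * y12)"
    and "a4 = 2 * (x11 * y11 - x12 * y12) * (x2 - y2)"
    and "a5 = (x11 * y11 - x12 * y12)^2"
  shows "Abs_fps (\<lambda>n. G n x11 x12 x2 y11 y12 y2) =
    (1 + fps_const a0 * fps_X + fps_const a1 * fps_X^2
       - fps_sqrt (1 + fps_const a2 * fps_X + fps_const a3 * fps_X^2
                     + fps_const a4 * fps_X^3 + fps_const a5 * fps_X^4))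
    / (2 * fps_X)"
proof -
  define F where "F = Abs_fps (\<lambda>n. G n x11 x12 x2 y11 y12 y2)"
  define P where "P = 1 + fps_const a0 * fps_X + fps_const a1 * fps_X^2"
  define A where "A = 1 + fps_const a2 * fps_X + fps_const a3 * fps_X^2
    + fps_const a4 * fps_X^3 + fps_const a5 * fps_X^4"
  have "fps_X * F\<^sup>2 + fps_const y2 + fps_const (x12 * y12 - x2 * y2) * fps_X = F * P"
    using tree_weight_gf_quadratic[of "x11 * y11" "x12 * y12" x2 y2]
    unfolding F_def P_def G_gf assms(1,2) by simp
  \<comment> \<open>\<open>A\<close> is the discriminant of the quadratic equation for
    \<open>F\<close>, so completing the square gives the next identity.\<close>
  moreover have "A = P\<^sup>2 - 4 * fps_X * (fps_const y2 + fps_const (x12 * y12 - x2 * y2) * fps_X)"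
    unfolding A_def P_def assms
    by (simp flip: fps_const_sub fps_const_add fps_const_mult fps_const_neg fps_const_power
        numeral_fps_const) algebra
  ultimately have "(P - 2 * fps_X * F)\<^sup>2 = A"
    by algebra
  \<comment> \<open>The constant term selects \<open>P - 2 * fps_X * F\<close>, not its negative, as
    the root.\<close>
  moreover have "fps_nth (P - 2 * fps_X * F) 0 = 1" "fps_nth A 0 = 1"
    by (simp_all add: P_def A_def mult.assoc)
  ultimately have "fps_sqrt A = P - 2 * fps_X * F"
    using fps_sqrt_iff by metis
  \<comment> \<open>\<open>2 * fps_X\<close> is not a unit, but the numerator is an exact multiple
    of it, so the division cancels.\<close>
  then have "(P - fps_sqrt A) / (2 * fps_X) = F * (2 * fps_X) / (2 * fps_X)"
    by (simp add: mult_ac)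
  also have "\<dots> = F"
    by (rule nonzero_mult_div_cancel_right) simp
  finally show ?thesis
    unfolding F_def P_def A_def ..
qed

end
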